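(* Let $G$ be a distribution function on $\mathbb{R}$ with density $g$, such that for every $\beta\in(0,1)$ the equation $G(u)=1-\beta$ has exactly one solution, denoted $u_\beta$ (the upper $100\beta\%$ point of $G$). Let $a:\mathbb{R}\to\mathbb{R}$ be a function, let $c_2,\tilde c_2>0$ be constants, and let $E\subset(0,\infty)$ be a set having $0$ as an accumulation point. For each $\epsilon\in E$ let $U=U_\epsilon$ be a real-valued random variable (a statistic) with $$F(x)\equiv\Pr\{U\le x\}=G(x)+\epsilon g(x)a(x)+R_2(x),\qquad |R_2(x)|\le c_2\epsilon^2\qquad\text{for all }x\in\mathbb{R},$$ and let $T=T_\epsilon$ be a strictly increasing function on an interval $I=I_\epsilon\subseteq\mathbb{R}$ containing all values of $U$, such that $$\Pr\{T(U)\le x\}=G(x)+\tilde R_2(x),\qquad|\tilde R_2(x)|\le\tilde d_2\equiv\tilde c_2\epsilon^2\qquad\text{for all }x\in\mathbb{R}.$$ Let $b=b_\epsilon:T(I)\to I$ be the function inverse to $T$, i.e. $b(T(x))=x$. First, fix $\epsilon\in E$ and $\alpha$ with $1-\tilde c_2\epsilon^2>\alpha>\tilde c_2\epsilon^2$. Let $x_\alpha$ and $\tilde x_\alpha$ be the (uniquely determined) upper $100\alpha\%$ points of the distributions of $U$ and $T(U)$, that is, $\Pr\{U\le x_\alpha\}=\Pr\{T(U)\le\tilde x_\alpha\}=1-\alpha$. Assume that $[u_{\alpha+\tilde d_2},u_{\alpha-\tilde d_2}]\subseteq T(I)$, that $b$ is differentiable on this interval, and that the quantities $$g(u_{(2)})=\min_{u\in[u_{\alpha+\tilde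 d_2},\,u_{\alpha-\tilde d_2}]}g(u),\qquad |b'(u^* )|=\max_{u\in[u_{\alpha+\tilde d_2},\,u_{\alpha-\tilde d_2}]}|b'(u)|$$ exist, with $g(u_{(2)})>0$. Then $x_\alpha=b(\tilde x_\alpha)$ and $$|x_\alpha-b(u_\alpha)|\le\tilde c_2\,\frac{|b'(u^* )|}{g(u_{(2)})}\,\epsilon^2.$$ Moreover, for every $x\in\mathbb{R}$ such that $g$ and $a$ are continuously differentiable in a neighbourhood of $x$, $g(x)>0$, and $x\in T_\epsilon(I_\epsilon)$ for all sufficiently small $\epsilon\in E$, $$b_\epsilon(x)=x-\epsilon a(x)+O(\epsilon^2)\qquad\text{as }\epsilon\to0,\ \epsilon\in E.$$
   Context: For a distribution function $H$ and $\beta\in(0,1)$, an upper $100\beta\%$ point of $H$ is a real number $x$ with $H(x)=1-\beta$. "Density $g$ of $G$" means $G(x)=\int_{-\infty}^x g(t)\,dt$ for all $x$. The parameter $\epsilon$ is typically $n^{-1/2}$ or $n^{-1}$ with $n$ the number of observations; $G$, $g$, $a$, $c_2$, $\tilde c_2$ do not depend on $\epsilon$, while $U$, $T$, $b$, $R_2$, $\tilde R_2$ may depend on it. *)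

theory Defs
  imports "HOL-Probability.Probability" "HOL-Library.Landau_Symbols"
begin

definition distribution_function :: "(real \<Rightarrow> real) \<Rightarrow> bool" where
  "distribution_function G \<longleftrightarrow> (\<exists>\<mu>. real_distribution \<mu> \<and> G = cdf \<mu>)"

(* Integrability is explicit because the Bochner integral of a non-integrable function is 0.
   Pointwise nonnegativity of g is not required; it holds almost everywhere whenever G is
   monotone. *)
definition density_of :: "(real \<Rightarrow> real) \<Rightarrow> (real \<Rightarrow> real) \<Rightarrow> bool" where
  "density_of g G \<longleftrightarrow>
     (\<forall>x. set_integrable lborel {..x} g \<and> G x = (LINT t:{..x}|lborel. g t))"

definition upper_point :: "(real \<Rightarrow> real) \<Rightarrow> real \<Rightarrow> real \<Rightarrow> bool" where
  "upper_point H \<beta> x \<longleftrightarrow> H x = 1 - \<beta>"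

end

theory Submission
  imports Defs
begin

text \<open>
  Strict monotonicity of \<open>T\<close> makes the events \<open>T(U) \<le> T(y)\<close> and \<open>U \<le> y\<close> coincide, so
  \<open>b\<close> carries the distribution function of \<open>T(U)\<close> to that of \<open>U\<close>. For the first claim,
  \<open>G\<close> differs by at most \<open>tc2 \<epsilon>\<^sup>2\<close> between \<open>tx\<^sub>\<alpha>\<close> and \<open>u \<alpha>\<close>; the lower bound on \<open>g\<close>
  turns this into a bound on their distance, and the bound on \<open>b'\<close> transports it through \<open>b\<close>.
  For the second, \<open>F(b(x)) = G(x) + O(\<epsilon>\<^sup>2)\<close>, while \<open>F\<close> evaluated at the two points
  \<open>x - \<epsilon> a(x) \<plusminus> K \<epsilon>\<^sup>2\<close> lies above and below this value once \<open>K\<close> is large; monotonicity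
  of \<open>F\<close> traps \<open>b(x)\<close> between them without any control of \<open>g\<close> and \<open>a\<close> away from \<open>x\<close>.
\<close>

section \<open>Increments of a distribution function in terms of its density\<close>

lemma density_of_diff:
  assumes "density_of g G" "p \<le> q"
  shows "set_integrable lborel {p<..q} g" "G q - G p = (LINT t:{p<..q}|lborel. g t)"
proof -
  have int: "set_integrable lborel {..z} g" and G: "G z = (LINT t:{..z}|lborel. g t)" for z
    using assms(1) by (auto simp: density_of_def)
  show int': "set_integrable lborel {p<..q} g"
    by (rule set_integrable_subset[OF int[of q]]) auto
  have "{..q} = {..p} \<union> {p<..q}"
    using assms(2) by auto
  then have "G q = (LINT t:{..p} \<union> {p<..q}|lborel. g t)"
    by (simp add: G)
  also have "\<dots> = G p + (LINT t:{p<..q}|lborel. g t)"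
    unfolding G[of p] by (rule set_integral_Un) (use int int' in auto)
  finally show "G q - G p = (LINT t:{p<..q}|lborel. g t)"
    by simp
qed

lemma density_of_diff_bounds:
  assumes "density_of g G" "p \<le> q"
  shows density_of_diff_ge: "(\<And>t. t \<in> {p<..q} \<Longrightarrow> m \<le> g t) \<Longrightarrow> m * (q - p) \<le> G q - G p"
    and density_of_diff_le: "(\<And>t. t \<in> {p<..q} \<Longrightarrow> g t \<le> m) \<Longrightarrow> G q - G p \<le> m * (q - p)"
proof -
  have const: "set_integrable lborel {p<..q} (\<lambda>_. m)"
    using integrable_real_indicator[of "{p<..q}" lborel]
    by (simp add: set_integrable_def emeasure_lborel_Ioc[OF assms(2)])
  have val: "(LINT t:{p<..q}|lborel. m) = m * (q - p)"
    using assms(2) by (simp add: set_lebesgue_integral_def)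
  note d = density_of_diff[OF assms]
  show "m * (q - p) \<le> G q - G p" if "\<And>t. t \<in> {p<..q} \<Longrightarrow> m \<le> g t"
    unfolding d(2) val[symmetric] by (rule set_integral_mono[OF const d(1) that])
  show "G q - G p \<le> m * (q - p)" if "\<And>t. t \<in> {p<..q} \<Longrightarrow> g t \<le> m"
    unfolding d(2) val[symmetric] by (rule set_integral_mono[OF d(1) const that])
qed

text \<open>Meant to be read backwards: for positive \<open>m\<close>, closeness of two values of
  \<open>G\<close> forces closeness of the points, whichever of them is larger. It is applied with
  \<open>m\<close> the minimum of \<open>g\<close> over the interval of upper points.\<close>

lemma density_of_abs_diff_ge:
  assumes "density_of g G" "p \<in> {l..r}" "q \<in> {l..r}" "\<And>t. t \<in> {l..r} \<Longrightarrow> m \<le> g t"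
  shows "m * \<bar>q - p\<bar> \<le> \<bar>G q - G p\<bar>"
proof (cases "p \<le> q")
  case True
  have "m * (q - p) \<le> G q - G p"
    by (rule density_of_diff_ge[OF assms(1) True]) (use assms in auto)
  then show ?thesis using True by auto
next
  case False
  then have "q \<le> p" by simp
  have "m * (p - q) \<le> G p - G q"
    by (rule density_of_diff_ge[OF assms(1) \<open>q \<le> p\<close>]) (use assms in auto)
  then show ?thesis using False by auto
qed

text \<open>Between \<open>x\<close> and \<open>z\<close> the density stays within
  \<open>L * |z - x|\<close> of \<open>g x\<close>; integrating this error over an interval of
  length \<open>|z - x|\<close> produces the square. Every comparison is with the value at the
  single point \<open>x\<close>.\<close>

lemma density_of_taylor:
  assumes G: "density_of g G"
    and lip: "\<And>t. \<bar>t - x\<bar> < d \<Longrightarrow> \<bar>g t - g x\<bar> \<le> L * \<bar>t - x\<bar>"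
    and L: "0 \<le> L" and z: "\<bar>z - x\<bar> < d"
  shows "\<bar>G z - G x - g x * (z - x)\<bar> \<le> L * (z - x)\<^sup>2"
proof -
  define r where "r = \<bar>z - x\<bar>"
  have g: "g x - L * r \<le> g t" "g t \<le> g x + L * r" if "\<bar>t - x\<bar> \<le> r" for t
    using lip[of t] mult_left_mono[OF that L] that z unfolding r_def by (auto simp: abs_le_iff)
  show ?thesis
  proof (cases "x \<le> z")
    case True
    have "(g x - L * r) * (z - x) \<le> G z - G x"
      by (rule density_of_diff_ge[OF G True], rule g) (auto simp: r_def)
    moreover have "G z - G x \<le> (g x + L * r) * (z - x)"
      by (rule density_of_diff_le[OF G True], rule g) (auto simp: r_def)
    ultimately show ?thesis using True
      by (auto simp: r_def abs_le_iff power2_eq_square algebra_simps)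
  next
    case False
    then have le: "z \<le> x" by simp
    have "(g x - L * r) * (x - z) \<le> G x - G z"
      by (rule density_of_diff_ge[OF G le], rule g) (auto simp: r_def)
    moreover have "G x - G z \<le> (g x + L * r) * (x - z)"
      by (rule density_of_diff_le[OF G le], rule g) (auto simp: r_def)
    ultimately show ?thesis using False
      by (auto simp: r_def abs_le_iff power2_eq_square algebra_simps)
  qed
qed

section \<open>Local inversion of a perturbed distribution function\<close>

lemma differentiable_imp_pointwise_Lipschitz:
  fixes f :: "real \<Rightarrow> real"
  assumes "(f has_real_derivative D) (at x)"
  obtains L d where "0 < L" "0 < d" "\<And>t. \<bar>t - x\<bar> < d \<Longrightarrow> \<bar>f t - f x\<bar> \<le> L * \<bar>t - x\<bar>"
proof -
  have "((\<lambda>t. \<bar>(f t - f x) / (t - x)\<bar>) \<longlongrightarrow> \<bar>D\<bar>) (at x)"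
    using assms by (intro tendsto_rabs) (simp add: has_field_derivative_iff)
  \<comment> \<open>Any constant above \<open>|D|\<close> bounds the quotient near \<open>x\<close>;
    the summand 1 gives the strict inequality and also keeps the Lipschitz constant positive when
    \<open>D = 0\<close>.\<close>
  then have "\<forall>\<^sub>F t in at x. \<bar>(f t - f x) / (t - x)\<bar> < \<bar>D\<bar> + 1"
    by (rule order_tendstoD) simp
  then obtain d where d: "0 < d"
    and q: "\<And>t. t \<noteq> x \<Longrightarrow> \<bar>t - x\<bar> < d \<Longrightarrow> \<bar>(f t - f x) / (t - x)\<bar> < \<bar>D\<bar> + 1"
    by (auto simp: eventually_at dist_real_def)
  have "\<bar>f t - f x\<bar> \<le> (\<bar>D\<bar> + 1) * \<bar>t - x\<bar>" if "\<bar>t - x\<bar> < d" for t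
  proof (cases "t = x")
    case False
    then show ?thesis
      using q[OF False that] by (simp add: abs_divide pos_divide_less_eq)
  qed simp
  then show thesis
    using that[of "\<bar>D\<bar> + 1" d] d by simp
qed

text \<open>\<open>K\<close> and \<open>d\<close> are fixed before \<open>\<epsilon>\<close>,
  \<open>F\<close> and \<open>y\<close>, so one pair of constants serves a whole family of
  distribution functions; this uniformity is what an O-statement in \<open>\<epsilon>\<close>
  requires. \<open>c\<close> measures the error of the expansion of \<open>F\<close>, and
  \<open>c'\<close> how well \<open>y\<close> solves \<open>F y = G x\<close>.\<close>

lemma perturbed_cdf_inversion:
  assumes G: "density_of g G"
    and g': "(g has_real_derivative Dg) (at x)" and a': "(a has_real_derivative Da) (at x)"
    and gx: "0 < g x" and c: "0 \<le> c" and c': "0 \<le> c'"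
  obtains K d where "0 < d"
    "\<And>\<epsilon> F y. 0 < \<epsilon> \<Longrightarrow> \<epsilon> < d \<Longrightarrow> mono F \<Longrightarrow>
       (\<And>z. \<bar>F z - (G z + \<epsilon> * g z * a z)\<bar> \<le> c * \<epsilon>\<^sup>2) \<Longrightarrow> \<bar>F y - G x\<bar> \<le> c' * \<epsilon>\<^sup>2 \<Longrightarrow>
       \<bar>y - (x - \<epsilon> * a x)\<bar> \<le> K * \<epsilon>\<^sup>2"
proof -
  obtain L1 d1 where L1: "0 < L1" "0 < d1"
    and g_lip: "\<And>t. \<bar>t - x\<bar> < d1 \<Longrightarrow> \<bar>g t - g x\<bar> \<le> L1 * \<bar>t - x\<bar>"
    using differentiable_imp_pointwise_Lipschitz[OF g'] by metis
  obtain L2 d2 where L2: "0 < L2" "0 < d2"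
    and ga_lip: "\<And>t. \<bar>t - x\<bar> < d2 \<Longrightarrow> \<bar>g t * a t - g x * a x\<bar> \<le> L2 * \<bar>t - x\<bar>"
    using differentiable_imp_pointwise_Lipschitz[OF DERIV_mult[OF g' a']] by metis
  \<comment> \<open>The trial points are
    \<open>z = x - \<epsilon> * a x + s * \<epsilon>\<^sup>2\<close> with \<open>s\<close> equal to
    \<open>K\<close> or \<open>- K\<close>. \<open>A\<close> bounds
    \<open>|z - x| / \<epsilon>\<close>. In units of \<open>\<epsilon>\<^sup>2\<close>,
    \<open>C\<close> adds up the Taylor error of \<open>G\<close>, the effect of moving
    \<open>g * a\<close> from \<open>x\<close> to \<open>z\<close>, and the remainder of
    \<open>F\<close>. \<open>K\<close> is chosen so that \<open>g x * K\<close> exceeds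
    \<open>C + c'\<close> by 1. In \<open>d\<close>, the bound \<open>1 / K\<close> gives
    \<open>K * \<epsilon> \<le> 1\<close>, which the 1 in \<open>A\<close> absorbs, and the other
    bound keeps \<open>z\<close> inside both Lipschitz neighbourhoods.\<close>
  define A where "A = \<bar>a x\<bar> + 1"
  define C where "C = L1 * A\<^sup>2 + L2 * A + c"
  define K where "K = (C + c' + 1) / g x"
  define d where "d = min (1 / K) (min d1 d2 / A)"
  have A: "0 < A" by (simp add: A_def add_nonneg_pos)
  have C: "0 \<le> C" using L1 L2 A c by (simp add: C_def)
  have K: "0 < K" using C c' gx by (simp add: K_def)
  have gK: "g x * K = C + c' + 1" using gx by (simp add: K_def)
  have d: "0 < d" using K A L1 L2 by (simp add: d_def)
  have "\<bar>y - (x - \<epsilon> * a x)\<bar> \<le> K * \<epsilon>\<^sup>2"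
    if \<epsilon>: "0 < \<epsilon>" "\<epsilon> < d" and F: "mono F"
      and Fexp: "\<And>z. \<bar>F z - (G z + \<epsilon> * g z * a z)\<bar> \<le> c * \<epsilon>\<^sup>2"
      and Fy: "\<bar>F y - G x\<bar> \<le> c' * \<epsilon>\<^sup>2" for \<epsilon> F y
  proof -
    have K\<epsilon>: "K * \<epsilon> \<le> 1" and A\<epsilon>: "A * \<epsilon> < d1" "A * \<epsilon> < d2"
      using \<epsilon> K A by (auto simp: d_def field_simps)
    have approx: "\<bar>F (x - \<epsilon> * a x + s * \<epsilon>\<^sup>2) - G x - g x * s * \<epsilon>\<^sup>2\<bar> \<le> C * \<epsilon>\<^sup>2" if s: "\<bar>s\<bar> = K" for s
    proof -
      define z where "z = x - \<epsilon> * a x + s * \<epsilon>\<^sup>2"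
      have "\<bar>z - x\<bar> = \<epsilon> * \<bar>s * \<epsilon> - a x\<bar>"
      proof -
        have "z - x = \<epsilon> * (s * \<epsilon> - a x)"
          by (simp add: z_def power2_eq_square algebra_simps)
        then show ?thesis using \<epsilon>(1) by (simp add: abs_mult)
      qed
      also have "\<bar>s * \<epsilon> - a x\<bar> \<le> A"
        using s K\<epsilon> \<epsilon>(1) abs_triangle_ineq4[of "s * \<epsilon>" "a x"] by (simp add: A_def abs_mult)
      finally have zx: "\<bar>z - x\<bar> \<le> A * \<epsilon>"
        using \<epsilon>(1) by (simp add: mult.commute)
      have "\<bar>G z - G x - g x * (z - x)\<bar> \<le> L1 * (z - x)\<^sup>2"
        by (rule density_of_taylor[OF G g_lip]) (use L1 zx A\<epsilon> in auto)
      also have "\<dots> \<le> L1 * (A * \<epsilon>)\<^sup>2"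
        using zx L1 power_mono[of "\<bar>z - x\<bar>" "A * \<epsilon>" 2] by simp
      finally have 1: "\<bar>G z - G x - g x * (z - x)\<bar> \<le> L1 * A\<^sup>2 * \<epsilon>\<^sup>2"
        by (simp add: power_mult_distrib mult.assoc)
      have "\<bar>g z * a z - g x * a x\<bar> \<le> L2 * (A * \<epsilon>)"
        using ga_lip[of z] mult_left_mono[OF zx, of L2] zx A\<epsilon> L2 by linarith
      then have "\<epsilon> * \<bar>g z * a z - g x * a x\<bar> \<le> \<epsilon> * (L2 * (A * \<epsilon>))"
        using \<epsilon>(1) by simp
      then have 2: "\<bar>\<epsilon> * (g z * a z - g x * a x)\<bar> \<le> L2 * A * \<epsilon>\<^sup>2"
        using \<epsilon>(1) by (simp add: abs_mult power2_eq_square mult_ac)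
      \<comment> \<open>Since \<open>z - x = - \<epsilon> * a x + s * \<epsilon>\<^sup>2\<close>,
        the first-order part of \<open>g x * (z - x)\<close> cancels
        \<open>\<epsilon> * g x * a x\<close>; only \<open>g x * s * \<epsilon>\<^sup>2\<close> and
        the three errors collected in \<open>C\<close> survive.\<close>
      have "F z - G x - g x * s * \<epsilon>\<^sup>2 =
          (F z - (G z + \<epsilon> * g z * a z)) + (G z - G x - g x * (z - x)) + \<epsilon> * (g z * a z - g x * a x)"
        by (simp add: z_def algebra_simps)
      moreover have "C * \<epsilon>\<^sup>2 = L1 * A\<^sup>2 * \<epsilon>\<^sup>2 + L2 * A * \<epsilon>\<^sup>2 + c * \<epsilon>\<^sup>2"
        by (simp add: C_def algebra_simps)
      ultimately show ?thesis
        using 1 2 Fexp[of z] unfolding z_def[symmetric] by linarith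
    qed
    \<comment> \<open>The spare \<open>\<epsilon>\<^sup>2\<close> makes the comparisons of
      \<open>F y\<close> with \<open>F\<close> at the trial points strict; for a monotone
      \<open>F\<close> that may have plateaus, only a strict inequality of values orders the
      arguments.\<close>
    have gK\<epsilon>: "g x * K * \<epsilon>\<^sup>2 = C * \<epsilon>\<^sup>2 + c' * \<epsilon>\<^sup>2 + \<epsilon>\<^sup>2"
      unfolding gK by (simp add: algebra_simps)
    have abs_K: "\<bar>K\<bar> = K" "\<bar>- K\<bar> = K" using K by auto
    have \<epsilon>2: "0 < \<epsilon>\<^sup>2" using \<epsilon> by simp
    have "F y < F (x - \<epsilon> * a x + K * \<epsilon>\<^sup>2)"
      using approx[OF abs_K(1)] Fy gK\<epsilon> \<epsilon>2 by linarith
    then have up: "y < x - \<epsilon> * a x + K * \<epsilon>\<^sup>2"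
      using monoD[OF F] by (metis not_less)
    have "F (x - \<epsilon> * a x + - K * \<epsilon>\<^sup>2) < F y"
      using approx[OF abs_K(2)] Fy gK\<epsilon> \<epsilon>2 by linarith
    then have "x - \<epsilon> * a x + - K * \<epsilon>\<^sup>2 < y"
      using monoD[OF F] by (metis not_less)
    with up show ?thesis by (simp add: abs_le_iff)
  qed
  with d show thesis by (rule that)
qed

section \<open>Monotone transformation of a statistic and location of upper points\<close>

lemma strict_mono_on_event_eq:
  fixes T :: "real \<Rightarrow> real"
  assumes "strict_mono_on A T" "\<And>\<omega>. \<omega> \<in> \<Omega> \<Longrightarrow> U \<omega> \<in> A" "y \<in> A"
  shows "{\<omega> \<in> \<Omega>. T (U \<omega>) \<le> T y} = {\<omega> \<in> \<Omega>. U \<omega> \<le> y}"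
  using assms strict_mono_on_less_eq[OF assms(1)] by blast

text \<open>Monotonicity alone would let \<open>z\<close> slip outside along a plateau of
  \<open>G\<close> at one of the two end levels. There \<open>G z\<close> would equal the end value,
  making \<open>z\<close> a second upper point, which uniqueness forbids. Larger levels have smaller
  upper points, hence the order of the endpoints.\<close>

lemma upper_point_mem_interval:
  assumes "mono G" and uniq: "\<And>\<beta>. 0 < \<beta> \<Longrightarrow> \<beta> < 1 \<Longrightarrow> \<exists>!v. upper_point G \<beta> v"
    and u: "\<And>\<beta>. 0 < \<beta> \<Longrightarrow> \<beta> < 1 \<Longrightarrow> upper_point G \<beta> (u \<beta>)"
    and "0 < \<alpha> - \<delta>" "\<alpha> + \<delta> < 1" "0 \<le> \<delta>" and z: "\<bar>G z - (1 - \<alpha>)\<bar> \<le> \<delta>"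
  shows "z \<in> {u (\<alpha> + \<delta>)..u (\<alpha> - \<delta>)}"
proof -
  have lo: "0 < \<alpha> + \<delta>" "\<alpha> + \<delta> < 1" and hi: "0 < \<alpha> - \<delta>" "\<alpha> - \<delta> < 1"
    using assms by auto
  have "G (u (\<alpha> + \<delta>)) \<le> G z" "G z \<le> G (u (\<alpha> - \<delta>))"
    using u[OF lo] u[OF hi] z by (auto simp: upper_point_def)
  then have "u (\<alpha> + \<delta>) \<le> z" "z \<le> u (\<alpha> - \<delta>)"
    using uniq[OF lo] uniq[OF hi] u[OF lo] u[OF hi] monoD[OF \<open>mono G\<close>]
    unfolding upper_point_def by (metis linorder_linear order_antisym)+
  then show ?thesis by simp
qed

theorem theorem3:
  fixes G g a :: "real \<Rightarrow> real"
    and u :: "real \<Rightarrow> real"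
    and c2 tc2 :: real
    and E :: "real set"
    and M :: "real \<Rightarrow> 'w measure"
    and U :: "real \<Rightarrow> 'w \<Rightarrow> real"
    and I :: "real \<Rightarrow> real set"
    and T b :: "real \<Rightarrow> real \<Rightarrow> real"
    and R2 tR2 :: "real \<Rightarrow> real \<Rightarrow> real"
  assumes G_df: "distribution_function G"
    and g_density: "density_of g G"
    and G_unique: "\<And>\<beta>. 0 < \<beta> \<Longrightarrow> \<beta> < 1 \<Longrightarrow> \<exists>!v. upper_point G \<beta> v"
    and u_upper: "\<And>\<beta>. 0 < \<beta> \<Longrightarrow> \<beta> < 1 \<Longrightarrow> upper_point G \<beta> (u \<beta>)"
    and c2_pos: "c2 > 0" and tc2_pos: "tc2 > 0"
    and E_pos: "E \<subseteq> {0<..}" and E_acc: "0 islimpt E"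
    and prob_M: "\<And>\<epsilon>. \<epsilon> \<in> E \<Longrightarrow> prob_space (M \<epsilon>)"
    and U_rv: "\<And>\<epsilon>. \<epsilon> \<in> E \<Longrightarrow> U \<epsilon> \<in> borel_measurable (M \<epsilon>)"
    and F_expansion: "\<And>\<epsilon> x. \<epsilon> \<in> E \<Longrightarrow>
        \<P>(\<omega> in M \<epsilon>. U \<epsilon> \<omega> \<le> x) = G x + \<epsilon> * g x * a x + R2 \<epsilon> x"
    and R2_bound: "\<And>\<epsilon> x. \<epsilon> \<in> E \<Longrightarrow> \<bar>R2 \<epsilon> x\<bar> \<le> c2 * \<epsilon>\<^sup>2"
    and I_interval: "\<And>\<epsilon>. \<epsilon> \<in> E \<Longrightarrow> is_interval (I \<epsilon>)"
    and U_values: "\<And>\<epsilon> \<omega>. \<epsilon> \<in> E \<Longrightarrow> \<omega> \<in> space (M \<epsilon>) \<Longrightarrow> U \<epsilon> \<omega> \<in> I \<epsilon>"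
    and T_mono: "\<And>\<epsilon>. \<epsilon> \<in> E \<Longrightarrow> strict_mono_on (I \<epsilon>) (T \<epsilon>)"
    and TU_expansion: "\<And>\<epsilon> x. \<epsilon> \<in> E \<Longrightarrow>
        \<P>(\<omega> in M \<epsilon>. T \<epsilon> (U \<epsilon> \<omega>) \<le> x) = G x + tR2 \<epsilon> x"
    and tR2_bound: "\<And>\<epsilon> x. \<epsilon> \<in> E \<Longrightarrow> \<bar>tR2 \<epsilon> x\<bar> \<le> tc2 * \<epsilon>\<^sup>2"
    and b_inverse: "\<And>\<epsilon> y. \<epsilon> \<in> E \<Longrightarrow> y \<in> I \<epsilon> \<Longrightarrow> b \<epsilon> (T \<epsilon> y) = y"
  shows "(\<forall>\<epsilon>\<in>E. \<forall>\<alpha> x\<^sub>\<alpha> tx\<^sub>\<alpha> u2 us b'.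
            let F = (\<lambda>x. \<P>(\<omega> in M \<epsilon>. U \<epsilon> \<omega> \<le> x));
                tF = (\<lambda>x. \<P>(\<omega> in M \<epsilon>. T \<epsilon> (U \<epsilon> \<omega>) \<le> x));
                td2 = tc2 * \<epsilon>\<^sup>2;
                J = {u (\<alpha> + td2)..u (\<alpha> - td2)}
            in
              tc2 * \<epsilon>\<^sup>2 < \<alpha> \<and> \<alpha> < 1 - tc2 * \<epsilon>\<^sup>2 \<and>
              (\<exists>!x. upper_point F \<alpha> x) \<and> upper_point F \<alpha> x\<^sub>\<alpha> \<and>
              (\<exists>!x. upper_point tF \<alpha> x) \<and> upper_point tF \<alpha> tx\<^sub>\<alpha> \<and>
              J \<subseteq> T \<epsilon> ` I \<epsilon> \<and>
              (\<forall>v\<in>J. (b \<epsilon> has_real_derivative b' v) (at v within J)) \<and>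
              is_arg_min g (\<lambda>v. v \<in> J) u2 \<and>
              is_arg_max (\<lambda>v. \<bar>b' v\<bar>) (\<lambda>v. v \<in> J) us \<and>
              g u2 > 0
              \<longrightarrow> x\<^sub>\<alpha> = b \<epsilon> tx\<^sub>\<alpha> \<and>
                  \<bar>x\<^sub>\<alpha> - b \<epsilon> (u \<alpha>)\<bar> \<le> tc2 * (\<bar>b' us\<bar> / g u2) * \<epsilon>\<^sup>2)
       \<and>
         (\<forall>x. (\<exists>S. open S \<and> x \<in> S \<and> g C1_differentiable_on S \<and> a C1_differentiable_on S) \<and>
              g x > 0 \<and>
              (\<forall>\<^sub>F \<epsilon> in at 0 within E. x \<in> T \<epsilon> ` I \<epsilon>)
              \<longrightarrow> (\<lambda>\<epsilon>. b \<epsilon> x - (x - \<epsilon> * a x)) \<in> O[at 0 within E](\<lambda>\<epsilon>. \<epsilon>\<^sup>2))"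
proof (intro conjI ballI allI impI, goal_cases)
  have "mono G"
  proof -
    obtain \<mu> where "real_distribution \<mu>" and G: "G = cdf \<mu>"
      using G_df by (auto simp: distribution_function_def)
    then interpret real_distribution \<mu> by simp
    show ?thesis unfolding G by (intro monoI cdf_nondecreasing)
  qed
  have transport: "\<P>(\<omega> in M \<epsilon>. T \<epsilon> (U \<epsilon> \<omega>) \<le> T \<epsilon> y) = \<P>(\<omega> in M \<epsilon>. U \<epsilon> \<omega> \<le> y)"
    if "\<epsilon> \<in> E" "y \<in> I \<epsilon>" for \<epsilon> y
    by (subst strict_mono_on_event_eq[OF T_mono[OF that(1)] _ that(2)]) (use U_values that in auto)
  {
    case (1 \<epsilon> \<alpha> x\<^sub>\<alpha> tx\<^sub>\<alpha> u2 us b')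
    define td2 where "td2 = tc2 * \<epsilon>\<^sup>2"
    define J where "J = {u (\<alpha> + td2)..u (\<alpha> - td2)}"
    show ?case
      unfolding Let_def
    proof (intro impI, elim conjE, fold td2_def, fold J_def)
      assume \<alpha>: "td2 < \<alpha>" "\<alpha> < 1 - td2"
        and F_unique: "\<exists>!x. upper_point (\<lambda>x. \<P>(\<omega> in M \<epsilon>. U \<epsilon> \<omega> \<le> x)) \<alpha> x"
        and x\<^sub>\<alpha>: "upper_point (\<lambda>x. \<P>(\<omega> in M \<epsilon>. U \<epsilon> \<omega> \<le> x)) \<alpha> x\<^sub>\<alpha>"
        and tx\<^sub>\<alpha>: "upper_point (\<lambda>x. \<P>(\<omega> in M \<epsilon>. T \<epsilon> (U \<epsilon> \<omega>) \<le> x)) \<alpha> tx\<^sub>\<alpha>"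
        and J_sub: "J \<subseteq> T \<epsilon> ` I \<epsilon>"
        and b': "\<forall>v\<in>J. (b \<epsilon> has_real_derivative b' v) (at v within J)"
        and u2: "is_arg_min g (\<lambda>v. v \<in> J) u2"
        and us: "is_arg_max (\<lambda>v. \<bar>b' v\<bar>) (\<lambda>v. v \<in> J) us"
        and gu2: "0 < g u2"
      have td2: "0 \<le> td2" using tc2_pos by (simp add: td2_def)
      have G_u: "G (u \<alpha>) = 1 - \<alpha>"
        using u_upper[of \<alpha>] \<alpha> td2 by (simp add: upper_point_def)
      have G_tx: "\<bar>G tx\<^sub>\<alpha> - (1 - \<alpha>)\<bar> \<le> td2"
        using tx\<^sub>\<alpha> TU_expansion[OF 1, of tx\<^sub>\<alpha>] tR2_bound[OF 1, of tx\<^sub>\<alpha>]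
        by (simp add: upper_point_def td2_def abs_le_iff)
      \<comment> \<open>Both \<open>tx\<^sub>\<alpha>\<close> and \<open>u \<alpha>\<close> have
        \<open>G\<close>-values within \<open>td2\<close> of \<open>1 - \<alpha>\<close>, so this
        places them in \<open>J\<close>, where the bounds on \<open>g\<close> and \<open>b'\<close>
        hold.\<close>
      have mem: "z \<in> J" if "\<bar>G z - (1 - \<alpha>)\<bar> \<le> td2" for z
        unfolding J_def
        by (rule upper_point_mem_interval[OF \<open>mono G\<close> G_unique u_upper]) (use \<alpha> td2 that in auto)
      have tx_J: "tx\<^sub>\<alpha> \<in> J" and u_J: "u \<alpha> \<in> J"
        using mem[OF G_tx] mem[of "u \<alpha>"] G_u td2 by auto
      \<comment> \<open>Membership in \<open>J\<close> also provides a preimage \<open>y\<close> of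
        \<open>tx\<^sub>\<alpha>\<close> under \<open>T\<close>. By transport \<open>y\<close> is an
        upper point of \<open>U\<close>, so uniqueness identifies it with
        \<open>x\<^sub>\<alpha>\<close>.\<close>
      from tx_J J_sub obtain y where y: "y \<in> I \<epsilon>" "tx\<^sub>\<alpha> = T \<epsilon> y" by auto
      have "upper_point (\<lambda>x. \<P>(\<omega> in M \<epsilon>. U \<epsilon> \<omega> \<le> x)) \<alpha> y"
        using tx\<^sub>\<alpha> transport[OF 1 y(1)] by (simp add: upper_point_def y(2))
      with x\<^sub>\<alpha> F_unique have "x\<^sub>\<alpha> = y" by auto
      then have x_b: "x\<^sub>\<alpha> = b \<epsilon> tx\<^sub>\<alpha>" using b_inverse[OF 1 y(1)] y(2) by simp
      have "g u2 * \<bar>tx\<^sub>\<alpha> - u \<alpha>\<bar> \<le> \<bar>G tx\<^sub>\<alpha> - G (u \<alpha>)\<bar>"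
        using u_J tx_J u2 unfolding J_def
        by (intro density_of_abs_diff_ge[OF g_density]) (auto simp: is_arg_min_def not_less)
      also have "\<dots> \<le> td2" using G_tx G_u by simp
      finally have dist: "\<bar>tx\<^sub>\<alpha> - u \<alpha>\<bar> \<le> td2 / g u2"
        using gu2 by (simp add: field_simps)
      \<comment> \<open>Mean value inequality on the convex set \<open>J\<close>; derivatives taken
        within \<open>J\<close> suffice, so they may be one-sided at the endpoints.\<close>
      have "norm (b \<epsilon> tx\<^sub>\<alpha> - b \<epsilon> (u \<alpha>)) \<le> \<bar>b' us\<bar> * norm (tx\<^sub>\<alpha> - u \<alpha>)"
        by (rule field_differentiable_bound[of J "b \<epsilon>" b'])
          (use b' us tx_J u_J in \<open>auto simp: is_arg_max_def not_less J_def\<close>)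
      also have "\<dots> \<le> \<bar>b' us\<bar> * (td2 / g u2)"
        using dist by (intro mult_left_mono) auto
      finally have "\<bar>x\<^sub>\<alpha> - b \<epsilon> (u \<alpha>)\<bar> \<le> tc2 * (\<bar>b' us\<bar> / g u2) * \<epsilon>\<^sup>2"
        by (simp add: x_b td2_def mult_ac)
      with x_b show "x\<^sub>\<alpha> = b \<epsilon> tx\<^sub>\<alpha> \<and> \<bar>x\<^sub>\<alpha> - b \<epsilon> (u \<alpha>)\<bar> \<le> tc2 * (\<bar>b' us\<bar> / g u2) * \<epsilon>\<^sup>2"
        by blast
    qed
  next
    case (2 x)
    then obtain Dg Da where Dg: "(g has_real_derivative Dg) (at x)"
      and Da: "(a has_real_derivative Da) (at x)"
      unfolding C1_differentiable_on_def has_real_derivative_iff_has_vector_derivative by metis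
    from 2 have gx: "0 < g x" by blast
    obtain K d where d: "0 < d" and inv: "\<And>\<epsilon> F y. 0 < \<epsilon> \<Longrightarrow> \<epsilon> < d \<Longrightarrow> mono F \<Longrightarrow>
       (\<And>z. \<bar>F z - (G z + \<epsilon> * g z * a z)\<bar> \<le> c2 * \<epsilon>\<^sup>2) \<Longrightarrow> \<bar>F y - G x\<bar> \<le> tc2 * \<epsilon>\<^sup>2 \<Longrightarrow>
       \<bar>y - (x - \<epsilon> * a x)\<bar> \<le> K * \<epsilon>\<^sup>2"
      using perturbed_cdf_inversion[OF g_density Dg Da gx, of c2 tc2] c2_pos tc2_pos
      by (metis less_imp_le)
    \<comment> \<open>The inversion lemma is applied with \<open>F\<close> the distribution function
      of \<open>U\<close> and \<open>y = b \<epsilon> x\<close>: transport turns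
      \<open>F (b \<epsilon> x)\<close> into the probability that \<open>T(U)\<close> is at most
      \<open>x\<close>, which differs from \<open>G x\<close> only by \<open>tR2\<close>.\<close>
    have bound: "\<bar>b \<epsilon> x - (x - \<epsilon> * a x)\<bar> \<le> K * \<epsilon>\<^sup>2" if \<epsilon>: "\<epsilon> \<in> E" "\<epsilon> < d" and x: "x \<in> T \<epsilon> ` I \<epsilon>" for \<epsilon>
    proof (rule inv)
      interpret prob_space "M \<epsilon>" by (rule prob_M[OF \<epsilon>(1)])
      note [measurable] = U_rv[OF \<epsilon>(1)]
      show "mono (\<lambda>z. \<P>(\<omega> in M \<epsilon>. U \<epsilon> \<omega> \<le> z))"
        by (intro monoI finite_measure_mono) (auto, measurable)
      from x obtain y where y: "y \<in> I \<epsilon>" "x = T \<epsilon> y" by auto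
      then have "b \<epsilon> x = y" using b_inverse[OF \<epsilon>(1)] by simp
      then have "\<P>(\<omega> in M \<epsilon>. U \<epsilon> \<omega> \<le> b \<epsilon> x) = G x + tR2 \<epsilon> x"
        using transport[OF \<epsilon>(1) y(1)] TU_expansion[OF \<epsilon>(1), of x] y(2) by simp
      then show "\<bar>\<P>(\<omega> in M \<epsilon>. U \<epsilon> \<omega> \<le> b \<epsilon> x) - G x\<bar> \<le> tc2 * \<epsilon>\<^sup>2"
        using tR2_bound[OF \<epsilon>(1), of x] by simp
      show "\<bar>\<P>(\<omega> in M \<epsilon>. U \<epsilon> \<omega> \<le> z) - (G z + \<epsilon> * g z * a z)\<bar> \<le> c2 * \<epsilon>\<^sup>2" for z
        using F_expansion[OF \<epsilon>(1), of z] R2_bound[OF \<epsilon>(1), of z] by simp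
    qed (use \<epsilon> E_pos in auto)
    \<comment> \<open>The filter supplies membership in \<open>E\<close>, and \<open>d\<close>
      itself serves as the radius around 0.\<close>
    have "\<forall>\<^sub>F \<epsilon> in at 0 within E. \<epsilon> \<in> E \<and> \<epsilon> < d"
      using d by (auto simp: eventually_at dist_real_def intro!: exI[of _ d])
    moreover have "\<forall>\<^sub>F \<epsilon> in at 0 within E. x \<in> T \<epsilon> ` I \<epsilon>"
      using 2 by blast
    ultimately have "\<forall>\<^sub>F \<epsilon> in at 0 within E. norm (b \<epsilon> x - (x - \<epsilon> * a x)) \<le> K * norm (\<epsilon>\<^sup>2)"
      by eventually_elim (simp add: bound)
    then show ?case by (rule bigoI)
  }
qed

end
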